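(* Let $\mathbf a=(a_1,\dots,a_h)$ ($h\ge2$) be a composition of $n$, let $\mathcal T$ be a planar rooted binary tree with $h$ leaves, let $0\le m\le n$, $Y=\{1,\dots,m\}$, and let $S_{n-m}\times S_m\le S_n$ be the stabilizer of $Y$. Then the set $$\{\Psi(\mathcal T(\mathbf a),m,\mathcal T_{\mathrm r}(\mathbf k)):\ \mathcal T_{\mathrm r}(\mathbf k)\text{ is a representation labeling of }\mathcal T\text{ for }(\mathbf a,m)\}$$ is an orthogonal basis for the space of $S_{n-m}\times S_m$-invariant functions in $M^{\mathbf a}$.
   Context: Composition: $a_1,\dots,a_h$ are positive integers with sum $n$. $\Omega_{\mathbf a}$ is the set of all $(B_1,\dots,B_h)$ of pairwise disjoint subsets of $\{1,\dots,n\}$ with $|B_r|=a_r$; $M^{\mathbf a}$ is the space of complex functions on $\Omega_{\mathbf a}$ with the natural $S_n$-action and inner product $\langle f_1,f_2\rangle=\sum f_1\overline{f_2}$. Trees: every internal vertex of $\mathcal T$ has exactly a left son and a right son; the leaves from left to right carry $a_1,\dots,a_h$. For a vertex $\tau$ let $N_\tau$ be the sum of the parts at the leaves of the subtree rooted at $\tau$. A representation labeling $\mathcal T_{\mathrm r}(\mathbf k)$ for $(\mathbf a,m)$ assigns to each vertex $\tau$ an integer $k_\tau\ge0$, with $k_\tau=0$ if $\tau$ is a leaf, such that for every internal $\tau$ with left son $\beta$ and right son $\gamma$: $0\le k_\beta\le N_\beta/2$, $0\le k_\gamma\le N_\gamma/2$, $k_\tau-N_\beta\le k_\gamma-k_\beta\le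 N_\gamma-k_\tau$, $k_\beta+k_\gamma\le k_\tau$; and the label $k$ of the root satisfies $k\le\min\{m,n-m\}$. $\mathcal T',\mathcal T''$ denote the subtrees rooted at the left and right sons of the root, with inherited labelings; $t$ is the number of leaves of $\mathcal T'$, $\underline a_t=a_1+\dots+a_t$, and $i,j$ are the labels of the left and right sons of the root. Multidimensional Hahn polynomials: for integers $\mathbf x=(x_1,\dots,x_h)$ with $0\le x_r\le a_r$ and $x_1+\dots+x_h=m$, define $E_{\mathcal T}(\mathbf x)$ recursively: it is $1$ if $\mathcal T$ is a single leaf; otherwise, with $w=x_{t+1}+\dots+x_h$, $$E_{\mathcal T}(\mathbf x)=E_{k-i-j}(n-\underline a_t-2j,\underline a_t-2i,m-i-j,w-j)\,E_{\mathcal T'}(x_1,\dots,x_t)\,E_{\mathcal T''}(x_{t+1},\dots,x_h)$$ if $\max\{j,i-\underline a_t+m\}\le w\le\min\{n-\underline a_t-j,m-i\}$, and $E_{\mathcal T}(\mathbf x)=0$ otherwise. Here, for integers with $0\le c\le a+b$, $0\le m\le\min\{a,b,c,a+b-c\}$, $\max\{c-b,0\}\le x\le\min\{a,c\}$, $E_m(a,b,c,x)=\sum_{r=\max\{0,x-c+m\}}^{\min\{m,x\}}(-1)^r\binom{m}{r}(b-m+1)_r(-x)_r(a-m+1)_{m-r}(x-c)_{m-r}$, with $(x)_s=x(x+1)\cdots(x+s-1)$. The function $\Psi(\mathcal T(\mathbf a),m,\mathcal T_{\mathrm r}(\mathbf k))\in M^{\mathbf a}$ is given by $(B_1,\dots,B_h)\mapsto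 E_{\mathcal T}(|B_1\cap Y|,\dots,|B_h\cap Y|)$. *)

theory Defs
  imports Complex_Main "HOL-Combinatorics.Permutations" "HOL-Library.Function_Algebras"
begin

definition cscale :: "complex \<Rightarrow> ('b \<Rightarrow> complex) \<Rightarrow> 'b \<Rightarrow> complex" where
  "cscale c f = (\<lambda>x. c * f x)"

global_interpretation cfun: vector_space cscale
  by unfold_locales (auto simp: cscale_def algebra_simps)

definition composition :: "nat list \<Rightarrow> nat \<Rightarrow> bool" where
  "composition a n \<longleftrightarrow> (\<forall>r \<in> set a. 0 < r) \<and> sum_list a = n"

text \<open>A tuple \<open>(B_1, \<dots>, B_h)\<close> is a list of length \<open>h\<close>; list positions start at \<open>0\<close>.\<close>

definition Omega :: "nat list \<Rightarrow> nat set list set" where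
  "Omega a = {B. length B = length a \<and>
     (\<forall>r < length a. B ! r \<subseteq> {1..sum_list a} \<and> card (B ! r) = a ! r) \<and>
     (\<forall>r < length a. \<forall>s < length a. r \<noteq> s \<longrightarrow> B ! r \<inter> B ! s = {})}"

text \<open>A function on \<open>Omega a\<close> is represented by its extension by zero to all lists of sets.\<close>

definition M :: "nat list \<Rightarrow> (nat set list \<Rightarrow> complex) set" where
  "M a = {f. \<forall>B. B \<notin> Omega a \<longrightarrow> f B = 0}"

definition inner_M :: "nat list \<Rightarrow> (nat set list \<Rightarrow> complex) \<Rightarrow> (nat set list \<Rightarrow> complex) \<Rightarrow> complex" where
  "inner_M a f1 f2 = (\<Sum>B \<in> Omega a. f1 B * cnj (f2 B))"

definition perm_act :: "(nat \<Rightarrow> nat) \<Rightarrow> (nat set list \<Rightarrow> complex) \<Rightarrow> nat set list \<Rightarrow> complex" where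
  "perm_act p f = (\<lambda>B. f (map (\<lambda>A. inv p ` A) B))"

text \<open>The subgroup \<open>S_{n-m} \<times> S_m\<close> of \<open>S_n\<close>, as the stabilizer of \<open>Y = {1..m}\<close>.\<close>

definition stabilizer :: "nat \<Rightarrow> nat \<Rightarrow> (nat \<Rightarrow> nat) set" where
  "stabilizer n m = {p. p permutes {1..n} \<and> p ` {1..m} = {1..m}}"

definition invariant_functions :: "nat list \<Rightarrow> nat \<Rightarrow> (nat set list \<Rightarrow> complex) set" where
  "invariant_functions a m =
     {f \<in> M a. \<forall>p \<in> stabilizer (sum_list a) m. perm_act p f = f}"

definition orthogonal_basis ::
  "nat list \<Rightarrow> (nat set list \<Rightarrow> complex) set \<Rightarrow> (nat set list \<Rightarrow> complex) set \<Rightarrow> bool" where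
  "orthogonal_basis a S V \<longleftrightarrow>
     cfun.independent S \<and> cfun.span S = V \<and> pairwise (\<lambda>f g. inner_M a f g = 0) S"

text \<open>
  Binary trees with a label at every vertex, leaves included. The bare planar tree is a
  \<open>unit btree\<close>, and a labeling of it is an \<open>int btree\<close> of that shape.
\<close>

datatype 'l btree = Leaf 'l | Node 'l "'l btree" "'l btree"

fun root_label :: "'l btree \<Rightarrow> 'l" where
  "root_label (Leaf k) = k"
| "root_label (Node k l r) = k"

fun num_leaves :: "'l btree \<Rightarrow> nat" where
  "num_leaves (Leaf k) = 1"
| "num_leaves (Node k l r) = num_leaves l + num_leaves r"

definition shape :: "'l btree \<Rightarrow> unit btree" where
  "shape = map_btree (\<lambda>_. ())"

text \<open>
  The list \<open>a\<close> holds the parts at the leaves of the given tree, from left to right, so the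
  leaves of its left subtree carry the first \<open>num_leaves l\<close> entries, and the number
  \<open>N\<close> of a subtree is the sum of the corresponding sublist.
\<close>

fun vertex_conditions :: "nat list \<Rightarrow> int btree \<Rightarrow> bool" where
  "vertex_conditions a (Leaf k) \<longleftrightarrow> k = 0"
| "vertex_conditions a (Node k l r) \<longleftrightarrow>
    (let al = take (num_leaves l) a; ar = drop (num_leaves l) a;
         Nl = int (sum_list al); Nr = int (sum_list ar);
         kl = root_label l; kr = root_label r
     in 0 \<le> k \<and>
        0 \<le> kl \<and> 2 * kl \<le> Nl \<and>
        0 \<le> kr \<and> 2 * kr \<le> Nr \<and>
        k - Nl \<le> kr - kl \<and> kr - kl \<le> Nr - k \<and>
        kl + kr \<le> k \<and>
        vertex_conditions al l \<and> vertex_conditions ar r)"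

definition rep_labeling :: "unit btree \<Rightarrow> nat list \<Rightarrow> nat \<Rightarrow> int btree \<Rightarrow> bool" where
  "rep_labeling T a m K \<longleftrightarrow>
     shape K = T \<and> vertex_conditions a K \<and>
     root_label K \<le> min (int m) (int (sum_list a) - int m)"

definition hahn :: "int \<Rightarrow> int \<Rightarrow> int \<Rightarrow> int \<Rightarrow> int \<Rightarrow> int" where
  "hahn m a b c x =
     (\<Sum>r = max 0 (x - c + m)..min m x.
        (-1) ^ nat r * int (nat m choose nat r) *
        pochhammer (b - m + 1) (nat r) * pochhammer (- x) (nat r) *
        pochhammer (a - m + 1) (nat (m - r)) * pochhammer (x - c) (nat (m - r)))"

text \<open>
  The parameter \<open>m\<close> of \<open>E\<close> is the sum of the arguments, at the root and at every
  recursive call.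
\<close>

fun tree_hahn :: "int btree \<Rightarrow> nat list \<Rightarrow> nat list \<Rightarrow> int" where
  "tree_hahn (Leaf k) a x = 1"
| "tree_hahn (Node k l r) a x =
    (let t = num_leaves l;
         n = int (sum_list a); a_t = int (sum_list (take t a));
         m = int (sum_list x); w = int (sum_list (drop t x));
         i = root_label l; j = root_label r
     in if max j (i - a_t + m) \<le> w \<and> w \<le> min (n - a_t - j) (m - i)
        then hahn (k - i - j) (n - a_t - 2 * j) (a_t - 2 * i) (m - i - j) (w - j) *
             tree_hahn l (take t a) (take t x) * tree_hahn r (drop t a) (drop t x)
        else 0)"

definition Psi :: "nat list \<Rightarrow> nat \<Rightarrow> int btree \<Rightarrow> nat set list \<Rightarrow> complex" where
  "Psi a m K = (\<lambda>B. if B \<in> Omega a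
     then of_int (tree_hahn K a (map (\<lambda>A. card (A \<inter> {1..m})) B)) else 0)"

end

theory Submission
  imports Defs
begin

text \<open>
  A function on \<open>\<Omega>\<^sub>a\<close> that is invariant under the stabilizer of \<open>Y = {1..m}\<close> depends on
  \<open>(B\<^sub>1, \<dots>, B\<^sub>h)\<close> only through its profile \<open>x\<^sub>r = \<bar>B\<^sub>r \<inter> Y\<bar>\<close>, because two tuples with the same profile
  are carried to each other by a permutation that preserves \<open>Y\<close> (\<open>ex_stabilizer_of_profile_eq\<close>). The number of
  tuples with profile \<open>x\<close> is \<open>\<Prod> (a\<^sub>r choose x\<^sub>r)\<close> times a factor that depends only on \<open>a\<close> and \<open>m\<close>
  (\<open>card_fibre_block_tuples\<close>). So the inner product becomes a sum over profiles, with a product of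
  binomial coefficients as weight; this is \<open>tree_form\<close>.

  The weight is multiplicative, so cutting the profiles at the root turns \<open>tree_form\<close> into a sum over
  the part \<open>w\<close> of \<open>m\<close> that falls to the right subtree: each term has the two Hahn values at the root
  and the forms of the subtrees at the levels \<open>m - w\<close> and \<open>w\<close>. The induction runs on the claim that
  forms of different labelings vanish and that the form of a labeling with root label \<open>k\<close> with itself,
  seen as a function of the level \<open>m\<close>, is a positive multiple of \<open>(n - 2k) choose (m - k)\<close>
  (\<open>tree_orthogonal\<close>, \<open>tree_norm\<close>). It closes because the two binomial coefficients contributed by the
  subtrees are precisely the weight for which the Hahn polynomials at the root are orthogonal, and
  because the norm of a Hahn polynomial depends on the level through a binomial coefficient again.

  Both facts on Hahn polynomials come from ladder operators. Write the variables as \<open>x\<close> and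
  \<open>y = c - x\<close>. The operators
  \<open>(U f) x y = x f (x-1) y + y f x (y-1)\<close> and \<open>(D f) x y = (a-x) f (x+1) y + (b-y) f x (y+1)\<close>
  change the level \<open>c\<close> by one, are adjoint for the binomial weights, and act on a Hahn polynomial of
  degree \<open>m\<close> by scalars. Comparing the scalars moves any inner product between levels; at the level of
  the larger of two degrees \<open>D\<close> annihilates one of the factors, which gives orthogonality.

  Finally the profiles are mapped injectively to the representation labelings (\<open>labeling_of\<close>): given
  the labels below and the level, the values \<open>w\<close> admitted at a vertex and the labels \<open>k\<close> admitted there are integer
  intervals of the same length. So there are at least as many functions \<open>\<Psi>\<close> as the dimension of the
  invariant space, and being orthogonal and nonzero they span it.
\<close>

section \<open>Hahn polynomials and ladder operators\<close>

text \<open>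
  The Hahn polynomial of degree \<open>m\<close> in the two variables \<open>x\<close> and \<open>y = c - x\<close>. In this form the level
  \<open>c\<close> is no longer a parameter, so that the values at all levels belong to one function, and
  the operators that shift the level act on it.
\<close>
definition hahn_poly :: "nat \<Rightarrow> nat \<Rightarrow> nat \<Rightarrow> nat \<Rightarrow> nat \<Rightarrow> int" where
  "hahn_poly m a b x y =
     (\<Sum>r\<le>m. (-1) ^ r * int (m choose r) *
        pochhammer (int b - int m + 1) r * pochhammer (int a - int m + 1) (m - r) *
        (pochhammer (- int x) r * pochhammer (- int y) (m - r)))"

text \<open>
  The summation range of \<open>hahn\<close> leaves out only zero terms: \<open>(-x)\<^sub>r = 0\<close> for \<open>r > x\<close> and
  \<open>(x-c)\<^sub>m\<^sub>-\<^sub>r = 0\<close> for \<open>m - r > c - x\<close>.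
\<close>
lemma hahn_eq_hahn_poly:
  assumes "x \<le> c" "m \<le> c"
  shows "hahn (int m) (int a) (int b) (int c) (int x) = hahn_poly m a b x (c - x)"
proof -
  let ?t = "\<lambda>r. (-1) ^ r * int (m choose r) *
        pochhammer (int b - int m + 1) r * pochhammer (- int x) r *
        pochhammer (int a - int m + 1) (m - r) * pochhammer (int x - int c) (m - r)"
  have range: "{max 0 (int x - int c + int m)..min (int m) (int x)} =
      int ` {m - (c - x)..min m x}"
    using assms by (simp add: image_int_atLeastAtMost max_def min_def of_nat_diff)
  have "hahn (int m) (int a) (int b) (int c) (int x) = (\<Sum>r = m - (c - x)..min m x. ?t r)"
    unfolding hahn_def range
    by (subst sum.reindex) (auto simp: nat_diff_distrib' intro!: sum.cong)
  also have "\<dots> = (\<Sum>r\<le>m. ?t r)"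
  proof (rule sum.mono_neutral_left)
    show "\<forall>r\<in>{..m} - {m - (c - x)..min m x}. ?t r = 0"
    proof
      fix r assume r: "r \<in> {..m} - {m - (c - x)..min m x}"
      then consider "x < r" | "c - x < m - r" by auto
      then show "?t r = 0"
      proof cases
        case 1
        then show ?thesis by (simp add: pochhammer_of_nat_eq_0_lemma)
      next
        case 2
        then have "pochhammer (- int (c - x)) (m - r) = (0::int)"
          by (rule pochhammer_of_nat_eq_0_lemma)
        then show ?thesis using assms by (simp add: of_nat_diff)
      qed
    qed
  qed auto
  finally show ?thesis
    using assms by (simp add: hahn_poly_def mult_ac)
qed

text \<open>
  The effect of one half of the raising operator on the factor \<open>(-x)\<^sub>r\<close>, which up to sign is the
  falling factorial \<open>x (x-1) \<dots> (x-r+1)\<close>. At \<open>x = 0\<close> the truncated \<open>x - 1\<close> is multiplied by zero.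
\<close>
lemma pochhammer_raise:
  "int x * pochhammer (- int (x - 1)) r = (int x - int r) * pochhammer (- int x) r"
proof (cases x)
  case 0
  then show ?thesis by (cases r) (auto simp: pochhammer_rec)
next
  case (Suc y)
  have "pochhammer (- int x) (Suc r) = - int x * pochhammer (- int x + 1) r"
    by (rule pochhammer_rec)
  moreover have "pochhammer (- int x) (Suc r) = (- int x + int r) * pochhammer (- int x) r"
    by (rule pochhammer_rec')
  ultimately show ?thesis using Suc by (simp add: algebra_simps)
qed

text \<open>
  The effect of one half of the lowering operator: besides a multiple of \<open>(-x)\<^sub>r\<close> it produces a term
  of degree \<open>r - 1\<close>.
\<close>
lemma pochhammer_lower:
  "(int a - int x) * pochhammer (- int (Suc x)) r =
     (int a - int x - int r) * pochhammer (- int x) r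
     - int r * (int a - int r + 1) * pochhammer (- int x) (r - 1)"
proof (cases r)
  case 0
  then show ?thesis by simp
next
  case (Suc q)
  have 1: "pochhammer (- int (Suc x)) (Suc q) = (- int x - 1) * pochhammer (- int x) q"
    by (simp add: pochhammer_rec)
  have 2: "pochhammer (- int x) (Suc q) = (- int x + int q) * pochhammer (- int x) q"
    by (rule pochhammer_rec')
  show ?thesis unfolding Suc 1 2 by (simp add: algebra_simps)
qed

text \<open>
  Every summand of the Hahn polynomial is by itself an eigenvector of the raising operator, and
  all have the eigenvalue \<open>(x - r) + (y - (m - r))\<close>.
\<close>
lemma hahn_poly_raise:
  "int x * hahn_poly m a b (x - 1) y + int y * hahn_poly m a b x (y - 1) =
     (int x + int y - int m) * hahn_poly m a b x y"
proof -
  define C where "C = (\<lambda>r. (-1) ^ r * int (m choose r) *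
        pochhammer (int b - int m + 1) r * pochhammer (int a - int m + 1) (m - r))"
  have H: "hahn_poly m a b x y =
      (\<Sum>r\<le>m. C r * (pochhammer (- int x) r * pochhammer (- int y) (m - r)))" for x y
    by (simp add: hahn_poly_def C_def)
  show ?thesis
    unfolding H sum_distrib_left sum.distrib[symmetric]
  proof (rule sum.cong)
    fix r assume "r \<in> {..m}"
    then have r: "int (m - r) = int m - int r" by (simp add: of_nat_diff)
    let ?P = "pochhammer (- int x) r" and ?Q = "pochhammer (- int y) (m - r)"
    have "int x * (C r * (pochhammer (- int (x - 1)) r * ?Q))
        + int y * (C r * (?P * pochhammer (- int (y - 1)) (m - r)))
        = C r * ?Q * (int x * pochhammer (- int (x - 1)) r)
        + C r * ?P * (int y * pochhammer (- int (y - 1)) (m - r))"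
      by (simp only: mult_ac)
    also have "\<dots> = (int x + int y - int m) * (C r * (?P * ?Q))"
      unfolding pochhammer_raise r by (simp add: algebra_simps)
    finally show "int x * (C r * (pochhammer (- int (x - 1)) r * ?Q))
        + int y * (C r * (?P * pochhammer (- int (y - 1)) (m - r)))
        = (int x + int y - int m) * (C r * (?P * ?Q))" .
  qed simp
qed

text \<open>
  Over the integers the factor \<open>a - x\<close> may be negative, and for \<open>x > a\<close> both sides vanish with their binomial
  coefficients. So sums over the whole range \<open>x \<le> c\<close> can be shifted without boundary terms.
\<close>
lemma choose_Suc_times: "int (a choose Suc x) * int (Suc x) = int (a choose x) * (int a - int x)"
proof (cases "x \<le> a")
  case True
  have "(a choose Suc x) * Suc x = (a choose x) * (a - x)"
    by (metis binomial_absorb_comp binomial_absorption mult.commute)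
  then have "int ((a choose Suc x) * Suc x) = int ((a choose x) * (a - x))" by simp
  then show ?thesis using True by (simp only: of_nat_mult of_nat_diff)
qed (simp add: binomial_eq_0)

text \<open>
  Lowering the summand with index \<open>r\<close> gives the scalar multiple claimed and two terms of lower degree,
  proportional to \<open>(-x)\<^sub>r\<^sub>-\<^sub>1 (-y)\<^sub>m\<^sub>-\<^sub>r\<close> and \<open>(-x)\<^sub>r (-y)\<^sub>m\<^sub>-\<^sub>r\<^sub>-\<^sub>1\<close>. The coefficients of the Hahn polynomial are
  such that these terms of neighbouring summands cancel.
\<close>
lemma hahn_poly_lower:
  "(int a - int x) * hahn_poly m a b (Suc x) y + (int b - int y) * hahn_poly m a b x (Suc y) =
     (int a + int b - int x - int y - int m) * hahn_poly m a b x y"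
proof -
  define C where "C = (\<lambda>r. (-1) ^ r * int (m choose r) *
        pochhammer (int b - int m + 1) r * pochhammer (int a - int m + 1) (m - r))"
  define P where "P = (\<lambda>z r. pochhammer (- int z) r :: int)"
  have H: "hahn_poly m a b x y = (\<Sum>r\<le>m. C r * (P x r * P y (m - r)))" for x y
    by (simp add: hahn_poly_def C_def P_def)
  let ?u = "\<lambda>r. C r * (int r * (int a - int r + 1) * P x (r - 1) * P y (m - r))"
  let ?v = "\<lambda>r. C r * (int (m - r) * (int b - int (m - r) + 1) * P x r * P y (m - r - 1))"
  have "(int a - int x) * hahn_poly m a b (Suc x) y + (int b - int y) * hahn_poly m a b x (Suc y)
      = (\<Sum>r\<le>m. (int a + int b - int x - int y - int m) * (C r * (P x r * P y (m - r)))
               - ?u r - ?v r)"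
    unfolding H sum_distrib_left sum.distrib[symmetric]
  proof (rule sum.cong)
    fix r assume "r \<in> {..m}"
    then have r: "int (m - r) = int m - int r" by (simp add: of_nat_diff)
    have "(int a - int x) * (C r * (P (Suc x) r * P y (m - r)))
        + (int b - int y) * (C r * (P x r * P (Suc y) (m - r)))
        = C r * P y (m - r) * ((int a - int x) * P (Suc x) r)
        + C r * P x r * ((int b - int y) * P (Suc y) (m - r))"
      by (simp only: mult_ac)
    also have "\<dots> = (int a + int b - int x - int y - int m) * (C r * (P x r * P y (m - r)))
               - ?u r - ?v r"
      unfolding P_def pochhammer_lower r by (simp add: algebra_simps)
    finally show "(int a - int x) * (C r * (P (Suc x) r * P y (m - r)))
        + (int b - int y) * (C r * (P x r * P (Suc y) (m - r)))
        = (int a + int b - int x - int y - int m) * (C r * (P x r * P y (m - r)))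
               - ?u r - ?v r" .
  qed simp
  \<comment> \<open>Shifting the index in the first sum pairs \<open>?u (r + 1)\<close> with \<open>?v r\<close>.\<close>
  moreover have "sum ?u {..m} + sum ?v {..m} = 0"
  proof (cases m)
    case (Suc q)
    have "sum ?u {..m} = (\<Sum>r\<le>q. ?u (Suc r))"
      unfolding Suc by (subst sum.atMost_Suc_shift) simp
    moreover have "sum ?v {..m} = (\<Sum>r\<le>q. ?v r)"
      unfolding Suc by simp
    moreover have "?u (Suc r) + ?v r = 0" if "r \<le> q" for r
    proof -
      have b: "int (m choose Suc r) * int (Suc r) = int (m choose r) * (int m - int r)"
        using choose_Suc_times[of m r] by simp
      have mr: "m - r = Suc (m - Suc r)" using that Suc by simp
      have c1: "pochhammer (int b - int m + 1) (Suc r)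
          = (int b - int m + 1 + int r) * pochhammer (int b - int m + 1) r"
        by (rule pochhammer_rec')
      have c2: "pochhammer (int a - int m + 1) (m - r)
          = (int a - int r) * pochhammer (int a - int m + 1) (m - Suc r)"
        unfolding mr pochhammer_rec' using that Suc by (simp add: of_nat_diff)
      have i: "int (m - r) = int m - int r" using that Suc by (simp add: of_nat_diff)
      have d: "m - r - 1 = m - Suc r" by simp
      have f: "int b - (int m - int r) + 1 = int b - int m + 1 + int r" by simp
      let ?R = "(-1) ^ r * pochhammer (int b - int m + 1) r
          * pochhammer (int a - int m + 1) (m - Suc r) * P x r * P y (m - Suc r)
          * (int a - int r) * (int b - int m + 1 + int r)"
      have "?u (Suc r) = - (?R * (int (m choose Suc r) * int (Suc r)))"
        by (simp add: C_def c1)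
      moreover have "?v r = ?R * (int (m choose r) * (int m - int r))"
        unfolding C_def c2 d i f by (simp only: mult_ac)
      ultimately show ?thesis unfolding b by simp
    qed
    ultimately show ?thesis by (simp add: sum.distrib[symmetric])
  qed simp
  ultimately show ?thesis
    unfolding H by (simp add: sum_subtractf sum_distrib_left)
qed

definition hahn_form ::
  "nat \<Rightarrow> nat \<Rightarrow> nat \<Rightarrow> (nat \<Rightarrow> nat \<Rightarrow> int) \<Rightarrow> (nat \<Rightarrow> nat \<Rightarrow> int) \<Rightarrow> int" where
  "hahn_form a b c f g =
     (\<Sum>x\<le>c. int (a choose x) * int (b choose (c - x)) * f x (c - x) * g x (c - x))"

text \<open>
  The two shifted binomial identities \<open>(a choose (x+1)) (x+1) = (a choose x) (a - x)\<close>, and the same for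
  \<open>b\<close>, move the raising operator to the other side as the lowering operator.
\<close>
lemma hahn_form_adjoint:
  "hahn_form a b (Suc c) (\<lambda>x y. int x * f (x - 1) y + int y * f x (y - 1)) g =
   hahn_form a b c f (\<lambda>x y. (int a - int x) * g (Suc x) y + (int b - int y) * g x (Suc y))"
proof -
  let ?A = "\<lambda>x. int (a choose x)" and ?B = "\<lambda>x. int (b choose x)"
  have "hahn_form a b (Suc c) (\<lambda>x y. int x * f (x - 1) y + int y * f x (y - 1)) g =
     (\<Sum>x\<le>Suc c. ?A x * ?B (Suc c - x) * (int x * f (x - 1) (Suc c - x)) * g x (Suc c - x))
   + (\<Sum>x\<le>Suc c. ?A x * ?B (Suc c - x) * (int (Suc c - x) * f x (c - x)) * g x (Suc c - x))"
    unfolding hahn_form_def sum.distrib[symmetric] by (intro sum.cong) (auto simp: algebra_simps)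
  also have "(\<Sum>x\<le>Suc c. ?A x * ?B (Suc c - x) * (int x * f (x - 1) (Suc c - x)) * g x (Suc c - x))
     = (\<Sum>x\<le>c. (?A (Suc x) * int (Suc x)) * ?B (c - x) * f x (c - x) * g (Suc x) (c - x))"
    by (subst sum.atMost_Suc_shift) (simp add: algebra_simps)
  also have "(\<Sum>x\<le>Suc c. ?A x * ?B (Suc c - x) * (int (Suc c - x) * f x (c - x)) * g x (Suc c - x))
     = (\<Sum>x\<le>c. ?A x * (?B (Suc (c - x)) * int (Suc (c - x))) * f x (c - x) * g x (Suc (c - x)))"
    by (auto intro!: sum.cong simp: Suc_diff_le algebra_simps)
  finally show ?thesis
    unfolding choose_Suc_times hahn_form_def sum.distrib[symmetric]
    by (simp add: algebra_simps)
qed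

text \<open>
  Evaluate \<open>\<langle>U f, g\<rangle> = \<langle>f, D g\<rangle>\<close> for two Hahn polynomials of degrees \<open>m\<close> and \<open>m'\<close>.
\<close>
lemma hahn_form_step:
  "(int (Suc c) - int m) * hahn_form a b (Suc c) (hahn_poly m a b) (hahn_poly m' a b) =
   (int a + int b - int m' - int c) * hahn_form a b c (hahn_poly m a b) (hahn_poly m' a b)"
proof -
  let ?H = "hahn_poly m a b" and ?H' = "hahn_poly m' a b"
  have "(int (Suc c) - int m) * hahn_form a b (Suc c) ?H ?H' =
     hahn_form a b (Suc c) (\<lambda>x y. (int x + int y - int m) * ?H x y) ?H'"
    unfolding hahn_form_def sum_distrib_left
    by (intro sum.cong) (auto simp: of_nat_diff)
  also have "\<dots> = hahn_form a b c ?H (\<lambda>x y. (int a + int b - int x - int y - int m') * ?H' x y)"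
    unfolding hahn_poly_raise[symmetric] hahn_form_adjoint hahn_poly_lower ..
  also have "\<dots> = (int a + int b - int m' - int c) * hahn_form a b c ?H ?H'"
    unfolding hahn_form_def sum_distrib_left
    by (intro sum.cong) (auto simp: of_nat_diff algebra_simps)
  finally show ?thesis .
qed

lemma hahn_form_commute: "hahn_form a b c f g = hahn_form a b c g f"
  unfolding hahn_form_def by (simp add: mult_ac)

text \<open>
  A Hahn polynomial of degree \<open>m'\<close> vanishes below level \<open>m'\<close>, since in each summand
  one of the two falling factorials is longer than its argument. One step up from there, the factor
  \<open>m' - m\<close> on the left of \<open>hahn_form_step\<close> is not zero.
\<close>
lemma hahn_form_lowest:
  assumes "m < m'"
  shows "hahn_form a b m' (hahn_poly m a b) (hahn_poly m' a b) = 0"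
proof -
  obtain c where c: "m' = Suc c" using assms by (cases m') auto
  have z: "hahn_poly m' a b x (c - x) = 0" if "x \<le> c" for x
    unfolding hahn_poly_def
  proof (rule sum.neutral, intro ballI)
    fix r assume "r \<in> {..m'}"
    have "x < r \<or> c - x < m' - r" using c that by arith
    then consider "x < r" | "c - x < m' - r" by blast
    then show "(- 1) ^ r * int (m' choose r) *
         pochhammer (int b - int m' + 1) r * pochhammer (int a - int m' + 1) (m' - r) *
         (pochhammer (- int x) r * pochhammer (- int (c - x)) (m' - r)) = 0"
      by cases (auto simp: pochhammer_of_nat_eq_0_lemma simp del: of_nat_diff)
  qed
  have "hahn_form a b c (hahn_poly m a b) (hahn_poly m' a b) = 0"
    unfolding hahn_form_def using z by (intro sum.neutral) auto
  with hahn_form_step[of c m a b m'] assms c show ?thesis by auto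
qed

lemma hahn_orthogonal_aux:
  assumes "m < m'" "m' \<le> c"
  shows "hahn_form a b c (hahn_poly m a b) (hahn_poly m' a b) = 0"
  using assms(2)
proof (induction c rule: dec_induct)
  case base
  show ?case using assms(1) by (rule hahn_form_lowest)
next
  case (step c)
  then show ?case using hahn_form_step[of c m a b m'] assms by auto
qed

lemma hahn_orthogonal:
  assumes "m \<noteq> m'" "m \<le> c" "m' \<le> c"
  shows "hahn_form a b c (hahn_poly m a b) (hahn_poly m' a b) = 0"
  using assms hahn_orthogonal_aux[of m m' c a b] hahn_orthogonal_aux[of m' m c a b]
  by (metis hahn_form_commute linorder_neqE_nat)

text \<open>
  At the lowest level the value at \<open>x = 0\<close> comes from the single summand \<open>r = 0\<close>, which is not zero.
\<close>
lemma hahn_norm_lowest_pos: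
  assumes "m \<le> a" "m \<le> b"
  shows "0 < hahn_form a b m (hahn_poly m a b) (hahn_poly m a b)"
proof -
  have "hahn_poly m a b 0 m = pochhammer (int a - int m + 1) m * pochhammer (- int m) m"
    unfolding hahn_poly_def by (subst sum.remove[of _ 0]) (auto simp: pochhammer_0_left)
  moreover have "pochhammer (int a - int m + 1) m > 0"
    using assms by (intro pochhammer_pos) auto
  moreover have "pochhammer (- int m) m \<noteq> 0"
    by (simp add: pochhammer_of_nat_eq_0_iff)
  ultimately have "hahn_poly m a b 0 m \<noteq> 0" by simp
  then show ?thesis unfolding hahn_form_def
    using assms by (intro sum_pos2[of _ 0]) (auto simp: mult.assoc zero_less_mult_iff)
qed

text \<open>
  For equal degrees the recursion of \<open>hahn_form_step\<close> is the one that \<open>N choose (c - m)\<close> with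
  \<open>N = a + b - 2 m\<close> satisfies in \<open>c\<close>.
\<close>
lemma hahn_norm:
  assumes "2 * m \<le> a + b" "m \<le> c"
  shows "hahn_form a b c (hahn_poly m a b) (hahn_poly m a b) =
    hahn_form a b m (hahn_poly m a b) (hahn_poly m a b) * int ((a + b - 2 * m) choose (c - m))"
  using assms(2)
proof (induction c rule: dec_induct)
  case base
  then show ?case by simp
next
  case (step c)
  let ?F = "\<lambda>c. hahn_form a b c (hahn_poly m a b) (hahn_poly m a b)" and ?N = "a + b - 2 * m"
  have "int (Suc (c - m)) * ?F (Suc c) = (int ?N - int (c - m)) * ?F c"
    using hahn_form_step[of c m a b m] step assms by (simp add: algebra_simps of_nat_diff)
  also have "\<dots> = ?F m * (int (?N choose (c - m)) * (int ?N - int (c - m)))"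
    unfolding step.IH by (simp only: mult_ac)
  also have "\<dots> = int (Suc (c - m)) * (?F m * int (?N choose Suc (c - m)))"
    unfolding choose_Suc_times[symmetric] by (simp only: mult_ac)
  finally show ?case using step by (simp add: Suc_diff_le)
qed

section \<open>Profiles and their weights\<close>

definition profiles :: "nat list \<Rightarrow> nat \<Rightarrow> nat list set" where
  "profiles a m = {x. list_all2 (\<le>) x a \<and> sum_list x = m}"

definition profile_weight :: "nat list \<Rightarrow> nat list \<Rightarrow> nat" where
  "profile_weight a x = prod_list (map2 (choose) a x)"

lemma finite_profiles [simp]: "finite (profiles a m)"
proof (rule finite_subset)
  show "profiles a m \<subseteq> {x. set x \<subseteq> {..m} \<and> length x = length a}"
    by (auto simp: profiles_def member_le_sum_list dest: list_all2_lengthD)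
qed (simp add: finite_lists_length_eq)

lemma profiles_append_image:
  "profiles (a @ b) m =
     (\<lambda>(w, u, v). u @ v) ` (SIGMA w:{..m}. profiles a (m - w) \<times> profiles b w)"
proof (intro equalityI subsetI)
  fix x assume "x \<in> profiles (a @ b) m"
  then obtain u v where "x = u @ v" "list_all2 (\<le>) u a" "list_all2 (\<le>) v b"
      "sum_list u + sum_list v = m"
    by (auto simp: profiles_def list_all2_append2)
  then show "x \<in> (\<lambda>(w, u, v). u @ v) ` (SIGMA w:{..m}. profiles a (m - w) \<times> profiles b w)"
    by (intro image_eqI[of _ _ "(sum_list v, u, v)"]) (auto simp: profiles_def)
qed (auto simp: profiles_def list_all2_appendI)

lemma sum_profiles_append:
  "(\<Sum>x\<in>profiles (a @ b) m. F x) =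
     (\<Sum>w\<le>m. \<Sum>u\<in>profiles a (m - w). \<Sum>v\<in>profiles b w. F (u @ v))"
proof -
  have "inj_on (\<lambda>(w, u, v). u @ v) (SIGMA w:{..m}. profiles a (m - w) \<times> profiles b w)"
    by (auto simp: inj_on_def profiles_def dest!: list_all2_lengthD)
  then show ?thesis
    unfolding profiles_append_image
    by (simp add: sum.reindex sum.Sigma sum.cartesian_product case_prod_unfold)
qed

lemma profile_weight_append:
  "length u = length a \<Longrightarrow> profile_weight (a @ b) (u @ v) = profile_weight a u * profile_weight b v"
  by (simp add: profile_weight_def)

section \<open>Orthogonality along a tree\<close>

lemma num_leaves_shape [simp]: "num_leaves (shape K) = num_leaves K"
  by (induction K) (auto simp: shape_def)

lemma root_label_nonneg: "vertex_conditions a K \<Longrightarrow> 0 \<le> root_label K"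
  by (cases K) (auto simp: Let_def)

definition tree_form :: "int btree \<Rightarrow> int btree \<Rightarrow> nat list \<Rightarrow> nat \<Rightarrow> int" where
  "tree_form K K' a m =
     (\<Sum>x\<in>profiles a m. int (profile_weight a x) * tree_hahn K a x * tree_hahn K' a x)"

text \<open>
  The factor that a vertex with label \<open>k\<close> contributes to \<open>tree_hahn\<close>: \<open>i\<close> and \<open>j\<close> are the labels of its
  sons, \<open>p\<close> and \<open>q\<close> the sums of the parts below them, and \<open>w\<close> the share of \<open>m\<close> that goes to the right.
\<close>
definition branch_hahn :: "int \<Rightarrow> int \<Rightarrow> int \<Rightarrow> nat \<Rightarrow> nat \<Rightarrow> nat \<Rightarrow> nat \<Rightarrow> int" where
  "branch_hahn k i j p q m w =
     (if max j (i - int p + int m) \<le> int w \<and> int w \<le> min (int q - j) (int m - i)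
      then hahn (k - i - j) (int q - 2 * j) (int p - 2 * i) (int m - i - j) (int w - j) else 0)"

lemma tree_hahn_Node_append:
  assumes "length u = num_leaves l" "length b = num_leaves l"
    and "sum_list v = w" "sum_list u = m - w" "w \<le> m"
  shows "tree_hahn (Node k l r) (b @ c) (u @ v) =
    branch_hahn k (root_label l) (root_label r) (sum_list b) (sum_list c) m w
      * tree_hahn l b u * tree_hahn r c v"
proof -
  have "int (sum_list (u @ v)) = int m" using assms by simp
  then show ?thesis using assms by (simp add: Let_def branch_hahn_def)
qed

text \<open>
  The root factors depend on a profile only through the sum \<open>w\<close> of its right part, and the remaining
  factors and the weight are products over the two parts.
\<close>
lemma tree_form_Node:
  assumes "length b = num_leaves l" "num_leaves l' = num_leaves l"
  shows "tree_form (Node k l r) (Node k' l' r') (b @ c) m =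
    (\<Sum>w\<le>m. branch_hahn k (root_label l) (root_label r) (sum_list b) (sum_list c) m w
         * branch_hahn k' (root_label l') (root_label r') (sum_list b) (sum_list c) m w
         * (tree_form l l' b (m - w) * tree_form r r' c w))"
proof -
  let ?g = "\<lambda>w. branch_hahn k (root_label l) (root_label r) (sum_list b) (sum_list c) m w"
  let ?g' = "\<lambda>w. branch_hahn k' (root_label l') (root_label r') (sum_list b) (sum_list c) m w"
  have "tree_form (Node k l r) (Node k' l' r') (b @ c) m =
    (\<Sum>w\<le>m. \<Sum>u\<in>profiles b (m - w). \<Sum>v\<in>profiles c w.
       ?g w * ?g' w * ((int (profile_weight b u) * tree_hahn l b u * tree_hahn l' b u)
         * (int (profile_weight c v) * tree_hahn r c v * tree_hahn r' c v)))"
    unfolding tree_form_def sum_profiles_append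
  proof (intro sum.cong refl)
    fix w u v assume "w \<in> {..m}" "u \<in> profiles b (m - w)" "v \<in> profiles c w"
    then have *: "length u = length b" "sum_list v = w" "sum_list u = m - w" "w \<le> m"
      by (auto simp: profiles_def dest: list_all2_lengthD)
    show "int (profile_weight (b @ c) (u @ v)) * tree_hahn (Node k l r) (b @ c) (u @ v)
          * tree_hahn (Node k' l' r') (b @ c) (u @ v) =
       ?g w * ?g' w * ((int (profile_weight b u) * tree_hahn l b u * tree_hahn l' b u)
         * (int (profile_weight c v) * tree_hahn r c v * tree_hahn r' c v))"
      using * assms
      by (simp only: tree_hahn_Node_append[where w = w and m = m] profile_weight_append
          of_nat_mult mult_ac)
  qed
  also have "\<dots> = (\<Sum>w\<le>m. ?g w * ?g' w * (tree_form l l' b (m - w) * tree_form r r' c w))"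
    by (simp only: tree_form_def sum_product) (simp only: sum_distrib_left)
  finally show ?thesis .
qed

text \<open>
  If the forms of the subtrees depend on their levels by the binomial coefficients of \<open>tree_norm\<close>, then the
  sum over \<open>w = x + j\<close> is the Hahn form at level \<open>c = m - i - j\<close>. The side condition in the definition of
  \<open>tree_hahn\<close> is harmless here: for \<open>0 \<le> x \<le> c\<close> it fails exactly where one of the binomial coefficients
  \<open>(q - 2j) choose x\<close> and \<open>(p - 2i) choose (c - x)\<close> is zero.
\<close>
lemma branch_hahn_sum:
  assumes "i + j \<le> k" "k \<le> m" "i + j \<le> k'" "k' \<le> m" "2 * i \<le> p" "2 * j \<le> q"
    and F: "\<And>w. w \<le> m \<Longrightarrow> i \<le> m - w \<Longrightarrow> m - w \<le> p - i \<Longrightarrow>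
      F w = C * int ((p - 2 * i) choose (m - w - i))"
    and G: "\<And>w. w \<le> m \<Longrightarrow> j \<le> w \<Longrightarrow> w \<le> q - j \<Longrightarrow>
      G w = D * int ((q - 2 * j) choose (w - j))"
  shows "(\<Sum>w\<le>m. branch_hahn (int k) (int i) (int j) p q m w
            * branch_hahn (int k') (int i) (int j) p q m w * (F w * G w)) =
     C * D * hahn_form (q - 2 * j) (p - 2 * i) (m - i - j)
       (hahn_poly (k - i - j) (q - 2 * j) (p - 2 * i))
       (hahn_poly (k' - i - j) (q - 2 * j) (p - 2 * i))"
proof -
  let ?a = "q - 2 * j" and ?b = "p - 2 * i" and ?c = "m - i - j"
  let ?H = "\<lambda>k. hahn_poly (k - i - j) ?a ?b"
  let ?t = "\<lambda>w. branch_hahn (int k) (int i) (int j) p q m w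
            * branch_hahn (int k') (int i) (int j) p q m w * (F w * G w)"
  have sub: "(\<lambda>x. x + j) ` {..?c} \<subseteq> {..m}" using assms by auto
  \<comment> \<open>Outside \<open>j \<le> w \<le> m - i\<close> the side condition fails and the summand is zero.\<close>
  have out: "?t w = 0" if "w \<in> {..m} - (\<lambda>x. x + j) ` {..?c}" for w
  proof -
    have "\<not> (j \<le> w \<and> w + i \<le> m)"
    proof
      assume "j \<le> w \<and> w + i \<le> m"
      then have "w = (w - j) + j" "w - j \<le> ?c" by auto
      then show False using that by blast
    qed
    then show ?thesis by (auto simp: branch_hahn_def)
  qed
  have br: "branch_hahn (int k) (int i) (int j) p q m (x + j) = ?H k x (?c - x)"
    if "i + j \<le> k" "k \<le> m" "x \<le> ?c" "x \<le> ?a" "?c - x \<le> ?b" for k x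
  proof -
    have "hahn (int (k - i - j)) (int ?a) (int ?b) (int ?c) (int x) = ?H k x (?c - x)"
      using that by (intro hahn_eq_hahn_poly) auto
    moreover have "int (k - i - j) = int k - int i - int j" "int ?a = int q - 2 * int j"
      "int ?b = int p - 2 * int i" "int ?c = int m - int i - int j"
      "int (x + j) - int j = int x"
      using that assms by (auto simp: of_nat_diff)
    moreover have "max (int j) (int i - int p + int m) \<le> int (x + j)"
      "int (x + j) \<le> min (int q - int j) (int m - int i)"
      using that assms by auto
    ultimately show ?thesis unfolding branch_hahn_def
      by (simp only: if_True simp_thms)
  qed
  have "sum ?t {..m} = sum ?t ((\<lambda>x. x + j) ` {..?c})"
    using sub out by (intro sum.mono_neutral_right) auto
  also have "\<dots> = (\<Sum>x\<le>?c. ?t (x + j))"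
    by (subst sum.reindex) (auto simp: inj_on_def)
  also have "\<dots> = (\<Sum>x\<le>?c. C * D * (int (?a choose x) * int (?b choose (?c - x))
       * ?H k x (?c - x) * ?H k' x (?c - x)))"
  proof (rule sum.cong[OF refl])
    fix x assume "x \<in> {..?c}"
    then have x: "x \<le> ?c" by simp
    show "?t (x + j) = C * D * (int (?a choose x) * int (?b choose (?c - x))
       * ?H k x (?c - x) * ?H k' x (?c - x))"
    proof (cases "x \<le> ?a \<and> ?c - x \<le> ?b")
      case True
      then have "F (x + j) = C * int (?b choose (?c - x))"
        using x assms(1-6) by (subst F) (auto simp: algebra_simps)
      moreover have "G (x + j) = D * int (?a choose x)"
        using x True assms(1-6) by (subst G) auto
      moreover note br[of k x] br[of k' x]
      ultimately show ?thesis using x True assms(1-6) by simp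
    next
      case False
      then have z: "int (?a choose x) * int (?b choose (?c - x)) = 0"
        by (auto simp: binomial_eq_0_iff)
      have "\<not> (max (int j) (int i - int p + int m) \<le> int (x + j) \<and>
          int (x + j) \<le> min (int q - int j) (int m - int i))"
        using False assms(1-6) by auto
      then have "branch_hahn (int k) (int i) (int j) p q m (x + j) = 0"
        unfolding branch_hahn_def by (rule if_not_P)
      then show ?thesis unfolding z by simp
    qed
  qed
  finally show ?thesis by (simp add: hahn_form_def sum_distrib_left)
qed

lemma profiles_single: "profiles [n] m = (if m \<le> n then {[m]} else {})"
  by (auto simp: profiles_def list_all2_Cons2)

text \<open>
  The conditions at an internal vertex in natural numbers. The last two inequalities say that
  the degree \<open>k - i - j\<close> of the Hahn polynomial at the vertex is at most each of its parameters
  \<open>q - 2j\<close> and \<open>p - 2i\<close>, which makes its norm positive.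
\<close>
lemma Node_labels:
  assumes "vertex_conditions (b @ c) (Node k l r)" "length b = num_leaves l"
  obtains i j k' where "root_label l = int i" "root_label r = int j" "k = int k'"
    "2 * i \<le> sum_list b" "2 * j \<le> sum_list c" "i + j \<le> k'"
    "k' - i - j \<le> sum_list c - 2 * j" "k' - i - j \<le> sum_list b - 2 * i"
    "vertex_conditions b l" "vertex_conditions c r"
proof (rule that[of "nat (root_label l)" "nat (root_label r)" "nat k"])
qed (use assms in \<open>auto simp: Let_def\<close>)

text \<open>
  The constant \<open>C\<close> must not depend on the level \<open>m\<close>, since the induction uses the form of a subtree
  at all its levels at once, as the weight for the vertex above.
\<close>
lemma tree_norm:
  assumes "vertex_conditions a K" "length a = num_leaves K"
  shows "\<exists>C>0. \<forall>m. root_label K \<le> int m \<and> int m \<le> int (sum_list a) - root_label K \<longrightarrow>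
    tree_form K K a m =
      C * int (nat (int (sum_list a) - 2 * root_label K) choose (m - nat (root_label K)))"
  using assms
proof (induction K arbitrary: a)
  case (Leaf k)
  then obtain n where "a = [n]" "k = 0" by (auto simp: length_Suc_conv)
  then show ?case
    by (intro exI[of _ 1]) (simp add: tree_form_def profiles_single profile_weight_def)
next
  case (Node k l r)
  define b c where "b = take (num_leaves l) a" and "c = drop (num_leaves l) a"
  have a: "a = b @ c" "length b = num_leaves l" "length c = num_leaves r"
    using Node.prems by (auto simp: b_def c_def)
  let ?p = "sum_list b" and ?q = "sum_list c"
  from Node.prems(1) a obtain i j kk where
    ij: "root_label l = int i" "root_label r = int j" "k = int kk" and
    le: "2 * i \<le> ?p" "2 * j \<le> ?q" "i + j \<le> kk"
       "kk - i - j \<le> ?q - 2 * j" "kk - i - j \<le> ?p - 2 * i" and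
    v: "vertex_conditions b l" "vertex_conditions c r"
    by (metis Node_labels)
  from Node.IH(1)[OF v(1) a(2)] ij le obtain C where C: "C > 0"
    "\<And>m. i \<le> m \<Longrightarrow> m \<le> ?p - i \<Longrightarrow> tree_form l l b m = C * int ((?p - 2 * i) choose (m - i))"
    by (force simp: nat_diff_distrib' nat_mult_distrib)
  from Node.IH(2)[OF v(2) a(3)] ij le obtain D where D: "D > 0"
    "\<And>m. j \<le> m \<Longrightarrow> m \<le> ?q - j \<Longrightarrow> tree_form r r c m = D * int ((?q - 2 * j) choose (m - j))"
    by (force simp: nat_diff_distrib' nat_mult_distrib)
  let ?a = "?q - 2 * j" and ?b = "?p - 2 * i" and ?k = "kk - i - j"
  let ?E = "hahn_form ?a ?b ?k (hahn_poly ?k ?a ?b) (hahn_poly ?k ?a ?b)"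
  have pos: "C * D * ?E > 0"
    using C D hahn_norm_lowest_pos[of ?k ?a ?b] le by simp
  have "tree_form (Node k l r) (Node k l r) a m =
      C * D * ?E * int (nat (int (sum_list a) - 2 * k) choose (m - nat k))"
    if m: "k \<le> int m" "int m \<le> int (sum_list a) - k" for m
  proof -
    have "tree_form (Node k l r) (Node k l r) a m =
      C * D * hahn_form ?a ?b (m - i - j) (hahn_poly ?k ?a ?b) (hahn_poly ?k ?a ?b)"
      using m le C(2) D(2) unfolding a(1) tree_form_Node[OF a(2) refl] ij
      by (intro branch_hahn_sum) auto
    also have "hahn_form ?a ?b (m - i - j) (hahn_poly ?k ?a ?b) (hahn_poly ?k ?a ?b) =
      ?E * int ((?a + ?b - 2 * ?k) choose (m - i - j - ?k))"
      using m le ij by (intro hahn_norm) auto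
    also have "?a + ?b - 2 * ?k = nat (int (sum_list a) - 2 * k)"
      using le ij a by (auto simp: nat_diff_distrib' nat_mult_distrib)
    also have "m - i - j - ?k = m - nat k" using le ij by auto
    finally show ?thesis by (simp add: mult_ac)
  qed
  with pos show ?case unfolding root_label.simps by blast
qed

text \<open>
  If the labelings differ somewhere below the root, each term of the sum over \<open>w\<close> with nonzero Hahn
  factors contains the form of a pair of different labelings at an admissible level. If they differ
  only at the root, the sum is an inner product of Hahn polynomials of different degrees.
\<close>
lemma tree_orthogonal:
  assumes "shape K = shape K'" "length a = num_leaves K"
    and "vertex_conditions a K" "vertex_conditions a K'"
    and "root_label K \<le> int m" "int m \<le> int (sum_list a) - root_label K"
    and "root_label K' \<le> int m" "int m \<le> int (sum_list a) - root_label K'"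
    and "K \<noteq> K'"
  shows "tree_form K K' a m = 0"
  using assms
proof (induction K arbitrary: a K' m)
  case (Leaf k)
  then show ?case by (cases K') (auto simp: shape_def)
next
  case (Node k l r)
  from Node.prems(1) obtain k' l' r' where K': "K' = Node k' l' r'"
      and sh: "shape l = shape l'" "shape r = shape r'"
    by (cases K') (auto simp: shape_def)
  have nl: "num_leaves l' = num_leaves l" using sh num_leaves_shape by metis
  define b c where "b = take (num_leaves l) a" and "c = drop (num_leaves l) a"
  have a: "a = b @ c" "length b = num_leaves l" "length c = num_leaves r"
    using Node.prems by (auto simp: b_def c_def)
  let ?p = "sum_list b" and ?q = "sum_list c"
  have lab: "vertex_conditions (b @ c) (Node k l r)" "vertex_conditions (b @ c) (Node k' l' r')"
    using Node.prems a K' by auto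
  then have v: "vertex_conditions b l" "vertex_conditions c r"
      "vertex_conditions b l'" "vertex_conditions c r'"
    using a nl by (auto simp: Let_def)
  show ?case
  proof (cases "l = l' \<and> r = r'")
    case False
    \<comment> \<open>Where neither Hahn factor is zero, the side condition puts the levels \<open>m - w\<close> and \<open>w\<close> in the range
     that the induction hypothesis covers, for both labelings.\<close>
    have "branch_hahn k (root_label l) (root_label r) ?p ?q m w
         * branch_hahn k' (root_label l') (root_label r') ?p ?q m w
         * (tree_form l l' b (m - w) * tree_form r r' c w) = 0" if "w \<le> m" for w
    proof (cases "branch_hahn k (root_label l) (root_label r) ?p ?q m w = 0
        \<or> branch_hahn k' (root_label l') (root_label r') ?p ?q m w = 0")
      case nz: False
      then have w: "root_label r \<le> int w" "int w \<le> int ?q - root_label r"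
        "root_label l \<le> int (m - w)" "int (m - w) \<le> int ?p - root_label l"
        "root_label r' \<le> int w" "int w \<le> int ?q - root_label r'"
        "root_label l' \<le> int (m - w)" "int (m - w) \<le> int ?p - root_label l'"
        using that by (auto simp: branch_hahn_def of_nat_diff split: if_splits)
      from False consider "l \<noteq> l'" | "r \<noteq> r'" by blast
      then have "tree_form l l' b (m - w) = 0 \<or> tree_form r r' c w = 0"
      proof cases
        case 1
        then show ?thesis using Node.IH(1)[OF sh(1) a(2) v(1,3)] w by blast
      next
        case 2
        then show ?thesis using Node.IH(2)[OF sh(2) a(3) v(2,4)] w by blast
      qed
      then show ?thesis by auto
    qed auto
    then show ?thesis unfolding K' a(1) tree_form_Node[OF a(2) nl] by (intro sum.neutral) auto
  next
    case True
    from lab(1) a(2) obtain i j kk where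
      ij: "root_label l = int i" "root_label r = int j" "k = int kk" and
      le: "2 * i \<le> ?p" "2 * j \<le> ?q" "i + j \<le> kk"
      by (metis Node_labels)
    from lab(2) a(2) True obtain kk' where k': "k' = int kk'" "i + j \<le> kk'"
      by (metis Node_labels ij(1,2) of_nat_eq_iff)
    from tree_norm[OF v(1) a(2)] ij le obtain C where C:
      "\<And>m. i \<le> m \<Longrightarrow> m \<le> ?p - i \<Longrightarrow> tree_form l l b m = C * int ((?p - 2 * i) choose (m - i))"
      by (force simp: nat_diff_distrib' nat_mult_distrib)
    from tree_norm[OF v(2) a(3)] ij le obtain D where D:
      "\<And>m. j \<le> m \<Longrightarrow> m \<le> ?q - j \<Longrightarrow> tree_form r r c m = D * int ((?q - 2 * j) choose (m - j))"
      by (force simp: nat_diff_distrib' nat_mult_distrib)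
    let ?a = "?q - 2 * j" and ?b = "?p - 2 * i"
    have eq: "l' = l" "r' = r" using True by auto
    have m: "kk \<le> m" "kk' \<le> m" "kk \<noteq> kk'" using Node.prems K' ij k' True by auto
    have "tree_form (Node k l r) K' a m = C * D * hahn_form ?a ?b (m - i - j)
        (hahn_poly (kk - i - j) ?a ?b) (hahn_poly (kk' - i - j) ?a ?b)"
      using m le k'(2) C D unfolding a(1) K' eq tree_form_Node[OF a(2) refl] ij k'(1)
      by (intro branch_hahn_sum) auto
    also have "\<dots> = 0" using m le k' by (subst hahn_orthogonal) auto
    finally show ?thesis .
  qed
qed

section \<open>From profiles to labelings\<close>

text \<open>
  Fix the labels \<open>i\<close> and \<open>j\<close> of the sons and put \<open>a = N\<^sub>\<gamma> - 2j\<close>, \<open>b = N\<^sub>\<beta> - 2i\<close>, \<open>c = m - i - j\<close>. The shares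
  \<open>x = w - j\<close> range over the integers from \<open>max 0 (c - b)\<close> to \<open>min a c\<close>, and the degrees \<open>k - i - j\<close> from
  \<open>0\<close> to the minimum of \<open>a\<close>, \<open>b\<close>, \<open>c\<close>, \<open>a + b - c\<close>. These intervals have the same length, and
  the label of the vertex is given by the translation between them.
\<close>
fun labeling_of :: "unit btree \<Rightarrow> nat list \<Rightarrow> nat list \<Rightarrow> int btree" where
  "labeling_of (Leaf u) a x = Leaf 0"
| "labeling_of (Node u l r) a x =
    (let t = num_leaves l;
         L = labeling_of l (take t a) (take t x); R = labeling_of r (drop t a) (drop t x);
         i = root_label L; j = root_label R
     in Node (i + int (sum_list (drop t x))
           - max 0 (int (sum_list x) + i - j - int (sum_list (take t a)))) L R)"

lemma rep_labeling_of:
  assumes "x \<in> profiles a m" "length a = num_leaves T"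
  shows "rep_labeling T a m (labeling_of T a x)"
  using assms
proof (induction T arbitrary: a x m)
  case (Leaf u)
  then show ?case
    by (auto simp: rep_labeling_def shape_def profiles_def length_Suc_conv list_all2_Cons2)
next
  case (Node u l r)
  define b c where "b = take (num_leaves l) a" and "c = drop (num_leaves l) a"
  define y z where "y = take (num_leaves l) x" and "z = drop (num_leaves l) x"
  have a: "a = b @ c" "length b = num_leaves l" "length c = num_leaves r"
    using Node.prems by (auto simp: b_def c_def)
  have x: "x = y @ z" by (simp add: y_def z_def)
  have "y \<in> profiles b (sum_list y)" "z \<in> profiles c (sum_list z)"
    using Node.prems(1) by (auto simp: profiles_def b_def c_def y_def z_def)
  with Node.IH a have IH: "rep_labeling l b (sum_list y) (labeling_of l b y)"
      "rep_labeling r c (sum_list z) (labeling_of r c z)"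
    by blast+
  have m: "m = sum_list y + sum_list z" using Node.prems(1) x by (auto simp: profiles_def)
  have len: "length y = num_leaves l"
    using Node.prems by (auto simp: profiles_def y_def dest!: list_all2_lengthD)
  have nl: "num_leaves (labeling_of l b y) = num_leaves l"
    using IH(1) num_leaves_shape[of "labeling_of l b y"] by (simp add: rep_labeling_def)
  show ?case
    using IH root_label_nonneg[of b "labeling_of l b y"] root_label_nonneg[of c "labeling_of r c z"]
    unfolding rep_labeling_def x a(1)
    by (simp add: len a m Let_def nl shape_def) (auto simp: max_def)
qed

text \<open>
  The subtrees of the labeling determine \<open>i\<close> and \<open>j\<close>, and then the root label determines the share \<open>w\<close>.
  So both parts of the two profiles have equal sums, as the induction hypothesis requires.
\<close>
lemma labeling_of_inj:
  assumes "x \<in> profiles a m" "y \<in> profiles a m" "length a = num_leaves T"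
    and "labeling_of T a x = labeling_of T a y"
  shows "x = y"
  using assms
proof (induction T arbitrary: a x y m)
  case (Leaf u)
  then show ?case by (auto simp: profiles_def length_Suc_conv list_all2_Cons2)
next
  case (Node u l r)
  let ?t = "num_leaves l"
  have eq: "labeling_of l (take ?t a) (take ?t x) = labeling_of l (take ?t a) (take ?t y)"
    "labeling_of r (drop ?t a) (drop ?t x) = labeling_of r (drop ?t a) (drop ?t y)"
    using Node.prems(4) by (auto simp: Let_def)
  have s: "sum_list x = m" "sum_list y = m" using Node.prems by (auto simp: profiles_def)
  then have w: "sum_list (drop ?t x) = sum_list (drop ?t y)"
    using Node.prems(4) eq by (simp add: Let_def)
  have st: "sum_list (take ?t x) + sum_list (drop ?t x) = sum_list x" for x :: "nat list"
    by (metis append_take_drop_id sum_list_append)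
  have w': "sum_list (take ?t x) = sum_list (take ?t y)" using st[of x] st[of y] s w by simp
  have "take ?t x = take ?t y"
    using Node.prems w' eq(1)
    by (intro Node.IH(1)[of _ "take ?t a" "sum_list (take ?t y)"]) (auto simp: profiles_def)
  moreover have "drop ?t x = drop ?t y"
    using Node.prems w eq(2)
    by (intro Node.IH(2)[of _ "drop ?t a" "sum_list (drop ?t y)"]) (auto simp: profiles_def)
  ultimately show ?case by (metis append_take_drop_id)
qed

section \<open>Counting the tuples with a given profile\<close>

text \<open>
  The same tuples as in \<open>Omega\<close>, but with blocks chosen one after the other from what is left of an arbitrary
  set \<open>S\<close>, which permits induction on the list of sizes.
\<close>
fun block_tuples :: "nat list \<Rightarrow> nat set \<Rightarrow> nat set list set" where
  "block_tuples [] S = {[]}"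
| "block_tuples (k # a) S = (\<Union>A\<in>{A. A \<subseteq> S \<and> card A = k}. (#) A ` block_tuples a (S - A))"

lemma block_tuples_iff:
  "B \<in> block_tuples a S \<longleftrightarrow> length B = length a \<and>
     (\<forall>r < length a. B ! r \<subseteq> S \<and> card (B ! r) = a ! r) \<and>
     (\<forall>r < length a. \<forall>s < length a. r \<noteq> s \<longrightarrow> B ! r \<inter> B ! s = {})"
proof (induction a arbitrary: B S)
  case Nil
  then show ?case by auto
next
  case (Cons k a)
  show ?case
  proof (cases B)
    case Nil
    then show ?thesis by auto
  next
    case B: (Cons A B')
    have "B \<in> block_tuples (k # a) S \<longleftrightarrow> A \<subseteq> S \<and> card A = k \<and> B' \<in> block_tuples a (S - A)"
      by (auto simp: B)
    also have "\<dots> \<longleftrightarrow> A \<subseteq> S \<and> card A = k \<and> length B' = length a \<and>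
       (\<forall>r < length a. B' ! r \<subseteq> S \<and> card (B' ! r) = a ! r) \<and>
       (\<forall>r < length a. A \<inter> B' ! r = {}) \<and>
       (\<forall>r < length a. \<forall>s < length a. r \<noteq> s \<longrightarrow> B' ! r \<inter> B' ! s = {})"
    proof -
      have "B' ! r \<subseteq> S - A \<longleftrightarrow> B' ! r \<subseteq> S \<and> A \<inter> B' ! r = {}" for r by blast
      moreover have "(\<forall>r<n. (P r \<and> Q r) \<and> R r) \<longleftrightarrow> (\<forall>r<n. P r \<and> R r) \<and> (\<forall>r<n. Q r)"
        for n :: nat and P Q R by blast
      ultimately show ?thesis unfolding Cons.IH by (simp only: conj_assoc)
    qed
    also have "\<dots> \<longleftrightarrow> length B = length (k # a) \<and>
     (\<forall>r < length (k # a). B ! r \<subseteq> S \<and> card (B ! r) = (k # a) ! r) \<and>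
     (\<forall>r < length (k # a). \<forall>s < length (k # a). r \<noteq> s \<longrightarrow> B ! r \<inter> B ! s = {})"
      unfolding B list.size add_Suc_right add_0_right All_less_Suc2 nth_Cons_0 nth_Cons_Suc
      by (simp add: Int_commute imp_conjR all_conj_distrib conj_ac)
    finally show ?thesis .
  qed
qed

lemma Omega_eq_block_tuples: "Omega a = block_tuples a {1..sum_list a}"
  by (rule set_eqI) (simp only: Omega_def block_tuples_iff mem_Collect_eq)

lemma finite_block_tuples [simp]: "finite S \<Longrightarrow> finite (block_tuples a S)"
  by (induction a arbitrary: S) auto

definition profile :: "nat set \<Rightarrow> nat set list \<Rightarrow> nat list" where
  "profile Y B = map (\<lambda>A. card (A \<inter> Y)) B"

lemma profile_mem_profiles:
  assumes "B \<in> block_tuples a S" "finite S" "card S = sum_list a"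
  shows "profile Y B \<in> profiles a (card (S \<inter> Y))"
  using assms
proof (induction a arbitrary: B S)
  case Nil
  then show ?case by (auto simp: profiles_def profile_def)
next
  case (Cons k a)
  then obtain A B' where B: "B = A # B'" "A \<subseteq> S" "card A = k" "B' \<in> block_tuples a (S - A)"
    by auto
  have fin: "finite A" "finite S" using B Cons.prems finite_subset by auto
  have "card (S - A) = sum_list a" using fin B Cons.prems by (simp add: card_Diff_subset)
  with Cons.IH[OF B(4)] fin have "profile Y B' \<in> profiles a (card ((S - A) \<inter> Y))" by auto
  moreover have "card (S \<inter> Y) = card (A \<inter> Y) + card ((S - A) \<inter> Y)"
    using fin B by (subst card_Un_disjoint[symmetric]) (auto intro!: arg_cong[of _ _ card])
  moreover have "card (A \<inter> Y) \<le> k" using fin B by (auto intro: card_mono)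
  ultimately show ?case by (auto simp: B profiles_def profile_def)
qed

text \<open>
  A subset \<open>A\<close> corresponds to the pair of its parts \<open>A \<inter> Y\<close> and \<open>A - Y\<close>.
\<close>
lemma card_split_subsets:
  assumes "finite S" "Y \<subseteq> S" "x \<le> k"
  shows "card {A. A \<subseteq> S \<and> card A = k \<and> card (A \<inter> Y) = x} =
    (card Y choose x) * (card (S - Y) choose (k - x))"
proof -
  have fin: "finite Y" "finite (S - Y)" using assms finite_subset by auto
  let ?P = "{A. A \<subseteq> Y \<and> card A = x} \<times> {A. A \<subseteq> S - Y \<and> card A = k - x}"
  have "bij_betw (\<lambda>(A, B). A \<union> B) ?P {A. A \<subseteq> S \<and> card A = k \<and> card (A \<inter> Y) = x}"
  proof (rule bij_betw_byWitness[where f' = "\<lambda>A. (A \<inter> Y, A - Y)"])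
    show "(\<lambda>(A, B). A \<union> B) ` ?P \<subseteq> {A. A \<subseteq> S \<and> card A = k \<and> card (A \<inter> Y) = x}"
    proof (rule image_subsetI)
      fix P assume "P \<in> ?P"
      then obtain A B where P: "P = (A, B)" "A \<subseteq> Y" "card A = x" "B \<subseteq> S - Y" "card B = k - x"
        by auto
      then have "finite A" "finite B" "A \<inter> B = {}" "(A \<union> B) \<inter> Y = A"
        using fin by (auto intro: finite_subset[of A Y] finite_subset[of B "S - Y"])
      then show "(case P of (A, B) \<Rightarrow> A \<union> B) \<in> {A. A \<subseteq> S \<and> card A = k \<and> card (A \<inter> Y) = x}"
        using P assms by (auto simp: card_Un_disjoint)
    qed
    show "(\<lambda>A. (A \<inter> Y, A - Y)) ` {A. A \<subseteq> S \<and> card A = k \<and> card (A \<inter> Y) = x} \<subseteq> ?P"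
    proof (rule image_subsetI)
      fix A assume A: "A \<in> {A. A \<subseteq> S \<and> card A = k \<and> card (A \<inter> Y) = x}"
      then have "finite A" using assms finite_subset by auto
      then show "(A \<inter> Y, A - Y) \<in> ?P" using A by (auto simp: card_Diff_subset_Int)
    qed
  qed auto
  then have "card {A. A \<subseteq> S \<and> card A = k \<and> card (A \<inter> Y) = x} = card ?P"
    by (simp add: bij_betw_same_card)
  also have "\<dots> = (card Y choose x) * (card (S - Y) choose (k - x))"
    using fin by (simp add: card_cartesian_product n_subsets)
  finally show ?thesis .
qed

text \<open>
  Choosing the first block leaves a smaller instance with \<open>S - A\<close> and \<open>Y - A\<close>. The factorials of the
  sizes are kept on the left so that the count needs no division.
\<close>
lemma card_fibre_block_tuples:
  assumes "finite S" "Y \<subseteq> S" "list_all2 (\<le>) x a"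
    and "sum_list x = card Y" "sum_list a = card S"
  shows "card {B \<in> block_tuples a S. profile Y B = x} * prod_list (map fact a) =
    fact (card Y) * fact (card (S - Y)) * profile_weight a x"
  using assms
proof (induction a arbitrary: S Y x)
  case Nil
  then have "S = {}" "Y = {}" "x = []" by auto
  moreover have "{B \<in> {[]}. profile Y B = []} = {[]}" by (auto simp: profile_def)
  ultimately show ?case by (simp add: profile_weight_def profile_def)
next
  case (Cons k a)
  then obtain z x' where x: "x = z # x'" "z \<le> k" "list_all2 (\<le>) x' a"
    by (auto simp: list_all2_Cons2)
  let ?F = "{A. A \<subseteq> S \<and> card A = k \<and> card (A \<inter> Y) = z}"
  let ?G = "\<lambda>A. {B \<in> block_tuples a (S - A). profile (Y - A) B = x'}"
  have finY: "finite Y" using Cons.prems finite_subset by auto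
  have prof: "profile Y B = profile (Y - A) B" if "B \<in> block_tuples a (S - A)" for A B
  proof -
    have "\<forall>C\<in>set B. C \<subseteq> S - A" using that by (force simp: block_tuples_iff in_set_conv_nth)
    then have "\<forall>C\<in>set B. C \<inter> Y = C \<inter> (Y - A)" by auto
    then show ?thesis by (simp add: profile_def)
  qed
  have eq: "{B \<in> block_tuples (k # a) S. profile Y B = x} = (\<Union>A\<in>?F. (#) A ` ?G A)"
  proof (intro equalityI subsetI)
    fix B assume "B \<in> {B \<in> block_tuples (k # a) S. profile Y B = x}"
    then obtain A B' where B: "B = A # B'" "A \<in> ?F" "B' \<in> block_tuples a (S - A)"
        "profile Y B' = x'"
      by (auto simp: x profile_def)
    then have "B' \<in> ?G A" using prof by auto
    then show "B \<in> (\<Union>A\<in>?F. (#) A ` ?G A)" using B(1,2) by blast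
  next
    fix B assume "B \<in> (\<Union>A\<in>?F. (#) A ` ?G A)"
    then obtain A B' where B: "B = A # B'" "A \<in> ?F" "B' \<in> ?G A" by blast
    then have "profile Y B' = x'" using prof by auto
    then show "B \<in> {B \<in> block_tuples (k # a) S. profile Y B = x}"
      using B by (auto simp: x profile_def)
  qed
  have sub: "sum_list x' \<le> sum_list a" using x(3)
    by (induction rule: list_all2_induct) auto
  have zY: "z \<le> card Y" "k - z \<le> card (S - Y)"
    using Cons.prems x finY sub by (auto simp: card_Diff_subset)
  have G: "card (?G A) * prod_list (map fact a) =
     fact (card Y - z) * fact (card (S - Y) - (k - z)) * profile_weight a x'" if "A \<in> ?F" for A
  proof -
    from that have A: "A \<subseteq> S" "card A = k" "card (A \<inter> Y) = z" by auto
    have finA: "finite A" using A Cons.prems finite_subset by auto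
    have cY: "card (Y - A) = card Y - z"
      using finY A card_Diff_subset_Int[of Y A] by (simp add: Int_commute)
    have cS: "card (S - A) = card S - k" using A finA by (simp add: card_Diff_subset)
    have "card (S - A - (Y - A)) = card (S - A) - card (Y - A)"
      using finY Cons.prems by (intro card_Diff_subset) auto
    also have "\<dots> = card (S - Y) - (k - z)"
      using cS cY x zY Cons.prems finY by (simp add: card_Diff_subset)
    finally have c: "card (S - A - (Y - A)) = card (S - Y) - (k - z)" .
    have "card (?G A) * prod_list (map fact a) =
      fact (card (Y - A)) * fact (card (S - A - (Y - A))) * profile_weight a x'"
      using Cons.prems x cY cS by (intro Cons.IH) auto
    then show ?thesis unfolding c cY .
  qed
  have finF: "finite ?F" using Cons.prems(1) by simp
  have "card {B \<in> block_tuples (k # a) S. profile Y B = x} = (\<Sum>A\<in>?F. card ((#) A ` ?G A))"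
    unfolding eq using finF Cons.prems(1) by (intro card_UN_disjoint) auto
  also have "\<dots> = (\<Sum>A\<in>?F. card (?G A))"
    by (intro sum.cong refl card_image) (auto simp: inj_on_def)
  finally have "card {B \<in> block_tuples (k # a) S. profile Y B = x} * prod_list (map fact (k # a)) =
     fact k * (\<Sum>A\<in>?F. card (?G A) * prod_list (map fact a))"
    by (simp add: sum_distrib_right[symmetric])
  also have "(\<Sum>A\<in>?F. card (?G A) * prod_list (map fact a)) =
    card ?F * (fact (card Y - z) * fact (card (S - Y) - (k - z)) * profile_weight a x')"
    by (simp add: G)
  also have "card ?F = (card Y choose z) * (card (S - Y) choose (k - z))"
    using Cons.prems x by (intro card_split_subsets) auto
  also have "fact k * ((card Y choose z) * (card (S - Y) choose (k - z)) *
       (fact (card Y - z) * fact (card (S - Y) - (k - z)) * profile_weight a x')) =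
     (fact z * fact (card Y - z) * (card Y choose z)) *
     (fact (k - z) * fact (card (S - Y) - (k - z)) * (card (S - Y) choose (k - z))) *
     ((k choose z) * profile_weight a x')"
    using binomial_fact_lemma[OF x(2)] by (simp add: mult_ac flip: binomial_fact_lemma[OF x(2)])
  also have "\<dots> = fact (card Y) * fact (card (S - Y)) * profile_weight (k # a) x"
    unfolding binomial_fact_lemma[OF zY(1)] binomial_fact_lemma[OF zY(2)]
    by (simp add: x profile_weight_def)
  finally show ?case .
qed

section \<open>Orbits of the stabilizer and invariant functions\<close>

lemma Union_block_tuples:
  assumes "B \<in> block_tuples a S" "finite S" "card S = sum_list a"
  shows "\<Union> (set B) = S"
  using assms
proof (induction a arbitrary: B S)
  case (Cons k a)
  then obtain A B' where B: "B = A # B'" "A \<subseteq> S" "card A = k" "B' \<in> block_tuples a (S - A)"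
    by auto
  moreover have "finite A" using B Cons.prems finite_subset by auto
  ultimately have "\<Union> (set B') = S - A"
    using Cons.prems by (intro Cons.IH) (auto simp: card_Diff_subset)
  then show ?case using B by auto
qed auto

text \<open>
  Give each point \<open>y\<close> as key the index of its block together with the truth value of \<open>y \<in> Y\<close>. Equal profiles
  mean that the two key functions have fibres of the same sizes, hence differ by a permutation of the
  points, and a permutation that respects the keys maps blocks to blocks and \<open>Y\<close> to itself.
\<close>
lemma ex_stabilizer_of_profile_eq:
  assumes B: "B \<in> Omega a" and B': "B' \<in> Omega a"
    and eq: "profile {1..m} B = profile {1..m} B'" and m: "m \<le> sum_list a"
  shows "\<exists>p\<in>stabilizer (sum_list a) m. B' = map ((`) p) B"
proof -
  let ?n = "sum_list a" and ?h = "length a"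
  define key where "key = (\<lambda>C y. (THE r. r < ?h \<and> y \<in> C ! r, y \<le> m))"
    for C :: "nat set list"
  have cell: "{y \<in> {1..?n}. key C y = (r, t)} =
      (if r < ?h then {y \<in> C ! r. y \<le> m \<longleftrightarrow> t} else {})" if C: "C \<in> Omega a" for C r t
  proof -
    \<comment> \<open>The blocks cover \<open>{1..n}\<close> because they are disjoint and their sizes add up to \<open>n\<close>,
       so the index is well defined.\<close>
    have idx: "\<exists>!r. r < ?h \<and> y \<in> C ! r" if y: "y \<in> {1..?n}" for y
    proof -
      have "y \<in> \<Union> (set C)" using Union_block_tuples[of C a "{1..?n}"] C y
        by (simp add: Omega_eq_block_tuples)
      then obtain r where "r < ?h" "y \<in> C ! r"
        using C by (auto simp: in_set_conv_nth Omega_def)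
      moreover have "s = r" if "s < ?h" "y \<in> C ! s" for s
        using C that \<open>r < ?h\<close> \<open>y \<in> C ! r\<close> unfolding Omega_def by blast
      ultimately show ?thesis by blast
    qed
    have "(THE r. r < ?h \<and> y \<in> C ! r) = r \<longleftrightarrow> r < ?h \<and> y \<in> C ! r" if "y \<in> {1..?n}" for y
      using theI'[OF idx[OF that]] the1_equality[OF idx[OF that]] by blast
    moreover have "y \<in> {1..?n}" if "r < ?h" "y \<in> C ! r" for y
      using C that unfolding Omega_def by blast
    ultimately show ?thesis by (auto simp: key_def)
  qed
  have card_cell: "card {y \<in> C ! r. y \<le> m \<longleftrightarrow> t} =
      (if t then profile {1..m} C ! r else a ! r - profile {1..m} C ! r)"
    if C: "C \<in> Omega a" and r: "r < ?h" for C r t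
  proof -
    have fin: "finite (C ! r)" and sub: "C ! r \<subseteq> {1..?n}" and c: "card (C ! r) = a ! r"
      and l: "length C = ?h"
      using C r finite_subset[of "C ! r" "{1..?n}"] by (auto simp: Omega_def)
    have p: "profile {1..m} C ! r = card (C ! r \<inter> {1..m})"
      using r l by (simp add: profile_def)
    have "{y \<in> C ! r. y \<le> m} = C ! r \<inter> {1..m}" using sub by auto
    moreover have "{y \<in> C ! r. \<not> y \<le> m} = C ! r - {1..m}" using sub by auto
    ultimately show ?thesis
      using fin unfolding p c[symmetric] by (cases t) (simp_all add: card_Diff_subset_Int)
  qed
  have "image_mset (key B) (mset_set {1..?n}) = image_mset (key B') (mset_set {1..?n})"
  proof (rule multiset_eqI)
    fix z :: "nat \<times> bool"
    obtain r t where z: "z = (r, t)" by (cases z)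
    have "count (image_mset (key C) (mset_set {1..?n})) z = card {y \<in> {1..?n}. key C y = z}" for C
      by (simp add: count_image_mset vimage_def Int_def conj_commute)
    then show "count (image_mset (key B) (mset_set {1..?n})) z =
        count (image_mset (key B') (mset_set {1..?n})) z"
      using card_cell[OF B] card_cell[OF B'] eq by (simp only: z cell[OF B] cell[OF B']) simp
  qed
  then obtain p where p: "p permutes {1..?n}" "\<forall>y\<in>{1..?n}. key B y = key B' (p y)"
    using image_mset_eq_implies_permutes[of "{1..?n}"] by blast
  have inj: "inj p" using p(1) by (rule permutes_inj)
  have len: "length B = ?h" "length B' = ?h" using B B' by (auto simp: Omega_def)
  have block: "p ` (B ! r) = B' ! r" if r: "r < ?h" for r
  proof (rule card_subset_eq)
    show "finite (B' ! r)" using B' r finite_subset[of "B' ! r" "{1..?n}"] by (auto simp: Omega_def)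
    show "p ` (B ! r) \<subseteq> B' ! r"
    proof (rule image_subsetI)
      fix y assume "y \<in> B ! r"
      then have y: "y \<in> {1..?n}" "key B y = (r, y \<le> m)"
        using cell[OF B, of r "y \<le> m"] r by auto
      then have "p y \<in> {1..?n}" "key B' (p y) = (r, y \<le> m)"
        using p permutes_in_image[OF p(1)] by auto
      then show "p y \<in> B' ! r" using cell[OF B', of r "y \<le> m"] r by auto
    qed
    show "card (p ` (B ! r)) = card (B' ! r)"
      using B B' r inj by (simp add: card_image inj_on_subset Omega_def)
  qed
  have "p ` {1..m} = {1..m}"
  proof (rule card_subset_eq)
    show "p ` {1..m} \<subseteq> {1..m}"
    proof (rule image_subsetI)
      fix y assume y: "y \<in> {1..m}"
      then have "y \<in> {1..?n}" using m by auto
      then have "key B y = key B' (p y)" "p y \<in> {1..?n}"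
        using p permutes_in_image[OF p(1)] by auto
      then show "p y \<in> {1..m}" using y by (auto simp: key_def)
    qed
  qed (use inj in \<open>auto simp: card_image inj_on_subset\<close>)
  with p(1) have "p \<in> stabilizer ?n m" by (simp add: stabilizer_def)
  moreover have "B' = map ((`) p) B" using len block by (intro nth_equalityI) auto
  ultimately show ?thesis by blast
qed

lemma map_image_mem_Omega:
  assumes "q permutes {1..sum_list a}" "B \<in> Omega a"
  shows "map ((`) q) B \<in> Omega a"
proof -
  have inj: "inj q" using assms(1) by (rule permutes_inj)
  show ?thesis
    unfolding Omega_def mem_Collect_eq
  proof (intro conjI allI impI)
    show len: "length (map ((`) q) B) = length a" using assms(2) by (simp add: Omega_def)
    fix r assume r: "r < length a"
    then show "map ((`) q) B ! r \<subseteq> {1..sum_list a}"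
      using assms len permutes_image[OF assms(1)] by (auto simp: Omega_def)
    show "card (map ((`) q) B ! r) = a ! r"
      using assms len r inj by (simp add: Omega_def card_image inj_on_subset)
    fix s assume s: "s < length a" "r \<noteq> s"
    then have "B ! r \<inter> B ! s = {}" using assms(2) r by (auto simp: Omega_def)
    then show "map ((`) q) B ! r \<inter> map ((`) q) B ! s = {}"
      using len r s inj by (simp add: image_Int[symmetric])
  qed
qed

lemma profile_map_image:
  assumes "inj q" "q ` Y = Y"
  shows "profile Y (map ((`) q) B) = profile Y B"
proof -
  have "card (q ` A \<inter> Y) = card (A \<inter> Y)" for A
    using assms by (metis card_image image_Int inj_on_subset subset_UNIV)
  then show ?thesis by (simp add: profile_def)
qed

lemma Psi_eq: "Psi a m K B = (if B \<in> Omega a then of_int (tree_hahn K a (profile {1..m} B)) else 0)"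
  by (simp add: Psi_def profile_def)

text \<open>
  A permutation that preserves \<open>Y\<close> does not change profiles.
\<close>
lemma Psi_invariant: "Psi a m K \<in> invariant_functions a m"
proof -
  have "perm_act p (Psi a m K) = Psi a m K" if "p \<in> stabilizer (sum_list a) m" for p
  proof
    fix B
    let ?C = "map ((`) (inv p)) B"
    have p: "p permutes {1..sum_list a}" "p ` {1..m} = {1..m}"
      using that by (auto simp: stabilizer_def)
    have ip: "inv p permutes {1..sum_list a}" using p(1) by (rule permutes_inv)
    have im: "inv p ` {1..m} = {1..m}" using image_inv_f_f[OF permutes_inj[OF p(1)], of "{1..m}"] p(2) by simp
    have "map ((`) p) ?C = B"
      using permutes_surj[OF p(1)] by (simp add: comp_def image_image surj_f_inv_f)
    then have "?C \<in> Omega a \<longleftrightarrow> B \<in> Omega a"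
      using map_image_mem_Omega[OF p(1), of ?C] map_image_mem_Omega[OF ip, of B] by auto
    moreover have "profile {1..m} ?C = profile {1..m} B"
      by (rule profile_map_image[OF permutes_inj[OF ip] im])
    ultimately show "perm_act p (Psi a m K) B = Psi a m K B"
      by (simp add: perm_act_def Psi_eq)
  qed
  then show ?thesis by (simp add: invariant_functions_def M_def Psi_eq)
qed

lemma finite_Omega [simp]: "finite (Omega a)"
  by (simp add: Omega_eq_block_tuples)

lemma profile_Omega:
  assumes "B \<in> Omega a" "m \<le> sum_list a"
  shows "profile {1..m} B \<in> profiles a m"
proof -
  have "{1..sum_list a} \<inter> {1..m} = {1..m}" using assms(2) by auto
  then show ?thesis
    using profile_mem_profiles[of B a "{1..sum_list a}" "{1..m}"] assms
    by (simp add: Omega_eq_block_tuples)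
qed

definition profile_indicator :: "nat list \<Rightarrow> nat \<Rightarrow> nat list \<Rightarrow> nat set list \<Rightarrow> complex" where
  "profile_indicator a m x = (\<lambda>B. if B \<in> Omega a \<and> profile {1..m} B = x then 1 else 0)"

lemma sum_fun_apply: "(\<Sum>x\<in>X. F x) B = (\<Sum>x\<in>X. F x B :: complex)"
  by (induction X rule: infinite_finite_induct) auto

text \<open>
  An invariant function is constant on the sets of tuples with a common profile. So the dimension of
  the invariant space is at most the number of profiles.
\<close>
lemma invariant_in_span_indicators:
  assumes "f \<in> invariant_functions a m" "m \<le> sum_list a"
  shows "f \<in> cfun.span (profile_indicator a m ` profiles a m)"
proof -
  have const: "f B = f B'" if same: "B \<in> Omega a" "B' \<in> Omega a" "profile {1..m} B = profile {1..m} B'"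
    for B B'
  proof -
    obtain p where p: "p \<in> stabilizer (sum_list a) m" "B' = map ((`) p) B"
      using ex_stabilizer_of_profile_eq[OF same assms(2)] by blast
    have "inj p" using p(1) permutes_inj by (auto simp: stabilizer_def)
    then have "map ((`) (inv p)) B' = B" unfolding p(2) by (simp add: comp_def image_image)
    moreover have "perm_act p f = f" using assms(1) p(1) by (simp add: invariant_functions_def)
    ultimately show ?thesis by (metis perm_act_def[of p f])
  qed
  define c where "c = (\<lambda>x. f (SOME B. B \<in> Omega a \<and> profile {1..m} B = x))"
  have c: "c (profile {1..m} B) = f B" if B: "B \<in> Omega a" for B
  proof -
    let ?C = "SOME C. C \<in> Omega a \<and> profile {1..m} C = profile {1..m} B"
    have "?C \<in> Omega a \<and> profile {1..m} ?C = profile {1..m} B"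
      by (rule someI[of _ B]) (use B in simp)
    then show ?thesis unfolding c_def using const[of ?C B] B by auto
  qed
  have eq: "f = (\<Sum>x\<in>profiles a m. cscale (c x) (profile_indicator a m x))"
  proof
    fix B
    show "f B = (\<Sum>x\<in>profiles a m. cscale (c x) (profile_indicator a m x)) B"
    proof (cases "B \<in> Omega a")
      case True
      have "(\<Sum>x\<in>profiles a m. c x * profile_indicator a m x B) =
          (\<Sum>x\<in>profiles a m. if x = profile {1..m} B then c x else 0)"
        using True by (intro sum.cong) (auto simp: profile_indicator_def)
      also have "\<dots> = c (profile {1..m} B)"
        using profile_Omega[OF True assms(2)] by simp
      finally have "(\<Sum>x\<in>profiles a m. c x * profile_indicator a m x B) =
          c (profile {1..m} B)" .
      then show ?thesis using c[OF True] by (simp add: sum_fun_apply cscale_def)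
    next
      case False
      then show ?thesis using assms(1)
        by (simp add: sum_fun_apply cscale_def profile_indicator_def invariant_functions_def M_def)
    qed
  qed
  show ?thesis
    by (subst eq) (intro cfun.span_sum cfun.span_scale cfun.span_base imageI)
qed

lemma invariant_subspace: "cfun.subspace (invariant_functions a m)"
  by (auto simp: cfun.subspace_def invariant_functions_def M_def perm_act_def cscale_def fun_eq_iff)

text \<open>
  Group the tuples by profile. Multiplying by \<open>\<Prod> a\<^sub>r!\<close> again avoids division.
\<close>
lemma inner_Psi:
  assumes "m \<le> sum_list a"
  shows "of_nat (prod_list (map fact a)) * inner_M a (Psi a m K) (Psi a m K') =
    of_int (fact m * fact (sum_list a - m) * tree_form K K' a m)"
proof -
  let ?S = "{1..sum_list a}" and ?Y = "{1..m}"
  let ?A = "of_nat (prod_list (map fact a)) :: complex"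
  define e where "e = (\<lambda>x. tree_hahn K a x * tree_hahn K' a x)"
  have "inner_M a (Psi a m K) (Psi a m K') = (\<Sum>B\<in>Omega a. of_int (e (profile ?Y B)))"
    unfolding inner_M_def by (intro sum.cong) (auto simp: Psi_eq e_def)
  also have "\<dots> = (\<Sum>x\<in>profiles a m. \<Sum>B\<in>{B \<in> Omega a. profile ?Y B = x}. of_int (e (profile ?Y B)))"
    using profile_Omega[OF _ assms] by (intro sum.group[symmetric]) auto
  also have "\<dots> = (\<Sum>x\<in>profiles a m. of_nat (card {B \<in> Omega a. profile ?Y B = x}) * of_int (e x))"
    by (intro sum.cong) auto
  finally have "?A * inner_M a (Psi a m K) (Psi a m K') =
    (\<Sum>x\<in>profiles a m. of_nat (card {B \<in> Omega a. profile ?Y B = x} * prod_list (map fact a)) * of_int (e x))"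
    by (simp only: sum_distrib_left of_nat_mult mult_ac)
  also have "\<dots> = (\<Sum>x\<in>profiles a m.
      of_nat (fact m * fact (sum_list a - m) * profile_weight a x) * of_int (e x))"
  proof (intro sum.cong refl)
    fix x assume "x \<in> profiles a m"
    then have "card {B \<in> block_tuples a ?S. profile ?Y B = x} * prod_list (map fact a) =
      fact (card ?Y) * fact (card (?S - ?Y)) * profile_weight a x"
      using assms by (intro card_fibre_block_tuples) (auto simp: profiles_def)
    moreover have "card (?S - ?Y) = sum_list a - m"
      using assms by (subst card_Diff_subset) auto
    ultimately show "of_nat (card {B \<in> Omega a. profile ?Y B = x} * prod_list (map fact a)) * of_int (e x) =
      (of_nat (fact m * fact (sum_list a - m) * profile_weight a x) * of_int (e x) :: complex)"
      by (simp only: Omega_eq_block_tuples card_atLeastAtMost diff_Suc_1)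
  qed
  also have "\<dots> = of_int (fact m * fact (sum_list a - m) * tree_form K K' a m)"
    by (simp only: tree_form_def e_def sum_distrib_left of_int_sum of_int_mult of_nat_mult
        of_nat_fact of_int_fact of_int_of_nat_eq mult_ac)
  finally show ?thesis .
qed

section \<open>Orthogonal families that span\<close>

lemma inner_M_add: "inner_M a (f + g) h = inner_M a f h + inner_M a g h"
  by (simp add: inner_M_def distrib_right sum.distrib)

lemma inner_M_scale: "inner_M a (cscale c f) h = c * inner_M a f h"
  by (simp add: inner_M_def cscale_def sum_distrib_left mult.assoc)

lemma inner_M_0: "inner_M a 0 h = 0"
  by (simp add: inner_M_def)

lemma orthogonal_independent:
  assumes "pairwise (\<lambda>f g. inner_M a f g = 0) S" "\<And>f. f \<in> S \<Longrightarrow> inner_M a f f \<noteq> 0"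
  shows "cfun.independent S"
proof (rule ccontr)
  assume "\<not> cfun.independent S"
  then obtain f where f: "f \<in> S" "f \<in> cfun.span (S - {f})" by (auto simp: cfun.dependent_def)
  have "inner_M a f f = 0"
    using f(2)
  proof (rule cfun.span_induct[where P = "\<lambda>g. inner_M a g f = 0"])
    show "cfun.subspace {g. inner_M a g f = 0}"
      by (simp add: cfun.subspace_def inner_M_add inner_M_scale inner_M_0)
    show "\<And>g. g \<in> S - {f} \<Longrightarrow> inner_M a g f = 0"
      using assms(1) f(1) by (auto simp: pairwise_def)
  qed
  with assms(2) f(1) show False by blast
qed

text \<open>
  A vector outside the span could be added to \<open>S\<close>, and the enlarged independent set would have more
  elements than the generating set \<open>D\<close>.
\<close>
lemma (in vector_space) independent_card_spans:
  assumes "independent S" "S \<subseteq> V" "V \<subseteq> span D" "finite D" "card D \<le> card S"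
  shows "V \<subseteq> span S"
proof
  fix f assume f: "f \<in> V"
  show "f \<in> span S"
  proof (rule ccontr)
    assume nf: "f \<notin> span S"
    then have "independent (insert f S)" using assms(1) by (simp add: independent_insert)
    moreover have "insert f S \<subseteq> span D" using assms f by auto
    ultimately have "finite (insert f S) \<and> card (insert f S) \<le> card D"
      by (intro independent_span_bound assms(4))
    moreover have "f \<notin> S" using nf span_base by blast
    ultimately show False using assms(5) by auto
  qed
qed

theorem corollary3p14:
  fixes a :: "nat list" and h n m :: nat and T :: "unit btree"
  assumes "length a = h" and "2 \<le> h"
    and "composition a n"
    and "num_leaves T = h"
    and "m \<le> n"
  shows "orthogonal_basis a {Psi a m K | K. rep_labeling T a m K} (invariant_functions a m)"
proof -
  have n: "m \<le> sum_list a" using assms by (simp add: composition_def)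
  let ?V = "invariant_functions a m"
  define S where "S = {Psi a m K | K. rep_labeling T a m K}"
  have fact_nz: "prod_list (map fact a) \<noteq> (0::nat)" by (auto simp: prod_list_zero_iff)
  have orth: "inner_M a (Psi a m K) (Psi a m K') = 0"
    if K: "rep_labeling T a m K" and K': "rep_labeling T a m K'" and "K \<noteq> K'" for K K'
  proof -
    have "tree_form K K' a m = 0"
      using K K' \<open>K \<noteq> K'\<close> assms num_leaves_shape[of K]
      by (intro tree_orthogonal) (auto simp: rep_labeling_def)
    then show ?thesis using inner_Psi[OF n, of K K'] fact_nz by simp
  qed
  have norm: "inner_M a (Psi a m K) (Psi a m K) \<noteq> 0" if K: "rep_labeling T a m K" for K
  proof -
    have v: "vertex_conditions a K" "length a = num_leaves K"
      and k: "root_label K \<le> int m" "int m \<le> int (sum_list a) - root_label K"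
      using K assms num_leaves_shape[of K] by (auto simp: rep_labeling_def)
    from tree_norm[OF v] k obtain C where "C > 0" "tree_form K K a m =
      C * int (nat (int (sum_list a) - 2 * root_label K) choose (m - nat (root_label K)))"
      by blast
    moreover have "m - nat (root_label K) \<le> nat (int (sum_list a) - 2 * root_label K)"
      using k root_label_nonneg[OF v(1)] by auto
    ultimately have "tree_form K K a m \<noteq> 0" by (simp add: binomial_eq_0_iff)
    then show ?thesis using inner_Psi[OF n, of K K] fact_nz by auto
  qed
  have inj: "K = K'" if "rep_labeling T a m K" "rep_labeling T a m K'" "Psi a m K = Psi a m K'"
    for K K'
    using orth[of K K'] norm[of K] that by auto
  have pw: "pairwise (\<lambda>f g. inner_M a f g = 0) S"
    using orth by (auto simp: pairwise_def S_def)
  have indep: "cfun.independent S"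
    using norm by (intro orthogonal_independent[OF pw]) (auto simp: S_def)
  define S0 where "S0 = (\<lambda>x. Psi a m (labeling_of T a x)) ` profiles a m"
  have lab: "rep_labeling T a m (labeling_of T a x)" if "x \<in> profiles a m" for x
    using rep_labeling_of[OF that] assms by simp
  have S0: "S0 \<subseteq> S" using lab by (auto simp: S0_def S_def)
  have "inj_on (\<lambda>x. Psi a m (labeling_of T a x)) (profiles a m)"
  proof (rule inj_onI)
    fix x y assume x: "x \<in> profiles a m" and y: "y \<in> profiles a m"
      and "Psi a m (labeling_of T a x) = Psi a m (labeling_of T a y)"
    then have "labeling_of T a x = labeling_of T a y" using lab inj by blast
    then show "x = y" using assms(1,4) by (intro labeling_of_inj[OF x y, of T]) auto
  qed
  then have card0: "card S0 = card (profiles a m)" unfolding S0_def by (rule card_image)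
  have SV: "S \<subseteq> ?V" using Psi_invariant by (auto simp: S_def)
  \<comment> \<open>It is enough to use the functions of the labelings \<open>labeling_of T a x\<close>: there are as many of them as
     indicators of profiles.\<close>
  have "?V \<subseteq> cfun.span S0"
  proof (rule cfun.independent_card_spans)
    show "cfun.independent S0" using indep S0 by (rule cfun.independent_mono)
    show "S0 \<subseteq> ?V" using S0 SV by blast
    show "?V \<subseteq> cfun.span (profile_indicator a m ` profiles a m)"
      using invariant_in_span_indicators[OF _ n] by blast
    show "card (profile_indicator a m ` profiles a m) \<le> card S0"
      unfolding card0 by (rule card_image_le) simp
  qed simp
  also have "\<dots> \<subseteq> cfun.span S" using S0 by (rule cfun.span_mono)
  finally have "cfun.span S = ?V"
    using cfun.span_minimal[OF SV invariant_subspace] by blast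
  with indep pw show ?thesis unfolding orthogonal_basis_def S_def[symmetric] by simp
qed

end
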